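(* A typical $T\in(\mathcal B_1(c_0),\mathrm{SOT})$ admits a non-zero non-supercyclic vector.
   Context: $c_0$ is the complex Banach space of null sequences indexed by $\mathbb Z_+$, and $\mathcal B_1(c_0)$ is the set of all bounded linear operators $T$ on $c_0$ with $\|T\|\le 1$. SOT (Strong Operator Topology) is the topology of pointwise norm convergence; $(\mathcal B_1(c_0),\mathrm{SOT})$ is a Polish space. "A typical $T\in(\mathcal B_1(c_0),\mathrm{SOT})$ satisfies (P)" means that the set of $T\in\mathcal B_1(c_0)$ satisfying (P) is comeager in $(\mathcal B_1(c_0),\mathrm{SOT})$. A vector $x$ is supercyclic for $T$ if $\{\lambda T^nx:\ n\ge0,\ \lambda\in\mathbb C\}$ is dense in $c_0$, and non-supercyclic otherwise. *)

theory Defs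
  imports "HOL-Analysis.Analysis"
begin

section \<open>The complex Banach space of null sequences\<close>

typedef c0 = "{f :: nat \<Rightarrow> complex. f \<longlonglongrightarrow> 0}"
  morphisms coord Abs_c0
proof
  show "(\<lambda>_. 0) \<in> {f :: nat \<Rightarrow> complex. f \<longlonglongrightarrow> 0}" by simp
qed

setup_lifting type_definition_c0

lemma coord_tendsto_0: "coord x \<longlonglongrightarrow> 0"
  using coord by auto

lemma c0_eqI: "(\<And>n. coord x n = coord y n) \<Longrightarrow> x = y"
  by (simp add: coord_inject[symmetric] fun_eq_iff)

instantiation c0 :: real_vector
begin

lift_definition zero_c0 :: c0 is "\<lambda>_. 0" by simp

lift_definition plus_c0 :: "c0 \<Rightarrow> c0 \<Rightarrow> c0" is "\<lambda>f g n. f n + g n"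
  using tendsto_add_zero by blast

lift_definition minus_c0 :: "c0 \<Rightarrow> c0 \<Rightarrow> c0" is "\<lambda>f g n. f n - g n"
  using tendsto_diff by fastforce

lift_definition uminus_c0 :: "c0 \<Rightarrow> c0" is "\<lambda>f n. - f n"
  using tendsto_minus by fastforce

lift_definition scaleR_c0 :: "real \<Rightarrow> c0 \<Rightarrow> c0" is "\<lambda>r f n. r *\<^sub>R f n"
  using tendsto_scaleR[OF tendsto_const] by fastforce

instance
  by standard (transfer, simp add: fun_eq_iff algebra_simps)+

end

lift_definition scaleC :: "complex \<Rightarrow> c0 \<Rightarrow> c0" (infixr "*\<^sub>C" 75) is "\<lambda>c f n. c * f n"
  by (rule tendsto_mult_right_zero)

lemma scaleC_of_real: "complex_of_real r *\<^sub>C x = r *\<^sub>R x"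
  by transfer (simp add: scaleR_conv_of_real)

lemma bdd_above_coord: "bdd_above (range (\<lambda>n. cmod (coord x n)))"
proof -
  have "Bseq (coord x)"
    using coord_tendsto_0 convergent_def convergent_imp_Bseq by blast
  then obtain K where "\<forall>n. cmod (coord x n) \<le> K"
    by (auto simp: Bseq_def)
  then show ?thesis
    by (intro bdd_aboveI2[where M = K]) simp
qed

instantiation c0 :: real_normed_vector
begin

definition norm_c0 :: "c0 \<Rightarrow> real"
  where "norm_c0 x = (SUP n. cmod (coord x n))"

definition dist_c0 :: "c0 \<Rightarrow> c0 \<Rightarrow> real"
  where "dist_c0 x y = norm (x - y)"

definition sgn_c0 :: "c0 \<Rightarrow> c0"
  where "sgn_c0 x = x /\<^sub>R norm x"

definition uniformity_c0 :: "(c0 \<times> c0) filter"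
  where "uniformity_c0 = (INF e\<in>{0<..}. principal {(x, y). dist x y < e})"

definition open_c0 :: "c0 set \<Rightarrow> bool"
  where "open_c0 U \<longleftrightarrow> (\<forall>x\<in>U. \<forall>\<^sub>F (x', y) in uniformity. x' = x \<longrightarrow> y \<in> U)"

instance
proof
  fix x y :: c0 and r :: real and U :: "c0 set"
  have le: "cmod (coord z n) \<le> norm z" for z :: c0 and n
    unfolding norm_c0_def by (rule cSUP_upper[OF UNIV_I bdd_above_coord])
  have leI: "norm z \<le> b" if "\<And>n. cmod (coord z n) \<le> b" for z :: c0 and b
    unfolding norm_c0_def by (rule cSUP_least) (use that in auto)
  show "dist x y = norm (x - y)" by (rule dist_c0_def)
  show "sgn x = x /\<^sub>R norm x" by (rule sgn_c0_def)
  show "uniformity = (INF e\<in>{0<..}. principal {(x, y). dist x (y::c0) < e})"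
    by (rule uniformity_c0_def)
  show "open U \<longleftrightarrow> (\<forall>x\<in>U. \<forall>\<^sub>F (x', y) in uniformity. x' = x \<longrightarrow> y \<in> U)"
    by (rule open_c0_def)
  show "norm x = 0 \<longleftrightarrow> x = 0"
  proof
    assume "norm x = 0"
    then have "coord x n = 0" for n using le[of x n] by simp
    then show "x = 0" by (intro c0_eqI) (simp add: zero_c0.rep_eq)
  next
    assume "x = 0"
    then show "norm x = 0" by (simp add: norm_c0_def zero_c0.rep_eq)
  qed
  show "norm (x + y) \<le> norm x + norm y"
  proof (rule leI)
    fix n
    show "cmod (coord (x + y) n) \<le> norm x + norm y"
      using norm_triangle_ineq[of "coord x n" "coord y n"] le[of x n] le[of y n]
      by (simp add: plus_c0.rep_eq)
  qed
  have scale_le: "norm (s *\<^sub>R z) \<le> \<bar>s\<bar> * norm z" for s and z :: c0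
    by (rule leI) (simp add: scaleR_c0.rep_eq mult_left_mono le)
  show "norm (r *\<^sub>R x) = \<bar>r\<bar> * norm x"
  proof (cases "r = 0")
    case True
    then show ?thesis by (simp add: norm_c0_def zero_c0.rep_eq)
  next
    case False
    have "\<bar>r\<bar> * norm x = \<bar>r\<bar> * norm (inverse r *\<^sub>R r *\<^sub>R x)" using False by simp
    also have "\<dots> \<le> \<bar>r\<bar> * (\<bar>inverse r\<bar> * norm (r *\<^sub>R x))"
      by (rule mult_left_mono[OF scale_le]) simp
    also have "\<dots> = norm (r *\<^sub>R x)" using False by (simp add: field_simps)
    finally show ?thesis using scale_le[of r x] by linarith
  qed
qed

end

lemma norm_coord_le: "cmod (coord x n) \<le> norm x"
  unfolding norm_c0_def by (rule cSUP_upper[OF UNIV_I bdd_above_coord])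

lemma norm_c0_leI: "(\<And>n. cmod (coord x n) \<le> b) \<Longrightarrow> norm x \<le> b"
  unfolding norm_c0_def by (rule cSUP_least) auto

lemma norm_scaleC: "norm (c *\<^sub>C x) = cmod c * norm x"
proof (cases "c = 0")
  case True
  then have "c *\<^sub>C x = 0" by (simp add: c0_eqI scaleC.rep_eq zero_c0.rep_eq)
  then show ?thesis using True by simp
next
  case False
  have "norm (d *\<^sub>C z) \<le> cmod d * norm z" for d z
    by (rule norm_c0_leI) (simp add: scaleC.rep_eq norm_mult mult_left_mono norm_coord_le)
  note le = this
  have eq: "x = inverse c *\<^sub>C c *\<^sub>C x" using False by (simp add: c0_eqI scaleC.rep_eq)
  have "cmod c * norm x \<le> cmod c * (cmod (inverse c) * norm (c *\<^sub>C x))"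
    by (subst eq) (rule mult_left_mono[OF le], simp)
  also have "\<dots> = norm (c *\<^sub>C x)" using False by (simp add: norm_inverse)
  finally show ?thesis using le[of c x] by linarith
qed

instance c0 :: banach
proof
  fix X :: "nat \<Rightarrow> c0"
  assume X: "Cauchy X"
  have coord_diff: "cmod (coord x n - coord y n) \<le> norm (x - y)" for x y n
    using norm_coord_le[of "x - y" n] by (simp add: minus_c0.rep_eq)
  have "Cauchy (\<lambda>k. coord (X k) n)" for n
  proof (rule metric_CauchyI)
    fix e :: real assume "0 < e"
    then obtain N where "\<And>j k. j \<ge> N \<Longrightarrow> k \<ge> N \<Longrightarrow> dist (X j) (X k) < e"
      using metric_CauchyD[OF X] by blast
    then show "\<exists>M. \<forall>j\<ge>M. \<forall>k\<ge>M. dist (coord (X j) n) (coord (X k) n) < e"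
      by (metis coord_diff dist_norm order.strict_trans1)
  qed
  then have "\<forall>n. \<exists>l. (\<lambda>k. coord (X k) n) \<longlonglongrightarrow> l"
    using Cauchy_convergent convergent_def by blast
  then obtain f where f: "\<And>n. (\<lambda>k. coord (X k) n) \<longlonglongrightarrow> f n" by metis
  have unif: "\<exists>N. \<forall>k\<ge>N. \<forall>n. cmod (coord (X k) n - f n) \<le> e" if "0 < e" for e
  proof -
    obtain N where N: "\<And>j k. j \<ge> N \<Longrightarrow> k \<ge> N \<Longrightarrow> dist (X j) (X k) < e"
      using metric_CauchyD[OF X \<open>0 < e\<close>] by blast
    have "cmod (coord (X k) n - f n) \<le> e" if "k \<ge> N" for k n
    proof (rule tendsto_upperbound)
      show "(\<lambda>j. cmod (coord (X k) n - coord (X j) n)) \<longlonglongrightarrow> cmod (coord (X k) n - f n)"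
        by (intro tendsto_intros f)
      show "\<forall>\<^sub>F j in sequentially. cmod (coord (X k) n - coord (X j) n) \<le> e"
        using eventually_ge_at_top[of N]
      proof eventually_elim
        case (elim j)
        have "norm (X k - X j) < e" using N[OF that elim] by (simp add: dist_norm)
        then show ?case using coord_diff[of "X k" n "X j"] by linarith
      qed
    qed simp
    then show ?thesis by blast
  qed
  have "f \<longlonglongrightarrow> 0"
  proof (rule LIMSEQ_I)
    fix e :: real assume e: "0 < e"
    obtain k where k: "\<And>n. cmod (coord (X k) n - f n) \<le> e / 2"
      using unif[of "e / 2"] e by auto
    obtain M where M: "\<And>n. n \<ge> M \<Longrightarrow> cmod (coord (X k) n) < e / 2"
      using LIMSEQ_D[OF coord_tendsto_0[of "X k"], of "e / 2"] e by auto
    have "norm (f n - 0) < e" if "n \<ge> M" for n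
    proof -
      have "cmod (f n) \<le> cmod (coord (X k) n) + cmod (coord (X k) n - f n)"
        by norm
      then show ?thesis using M[OF that] k[of n] by simp
    qed
    then show "\<exists>M. \<forall>n\<ge>M. norm (f n - 0) < e" by blast
  qed
  then have coord_f: "coord (Abs_c0 f) = f" by (simp add: Abs_c0_inverse)
  have "X \<longlonglongrightarrow> Abs_c0 f"
  proof (rule LIMSEQ_I)
    fix e :: real assume e: "0 < e"
    obtain N where N: "\<And>k n. k \<ge> N \<Longrightarrow> cmod (coord (X k) n - f n) \<le> e / 2"
      using unif[of "e / 2"] e by auto
    have "norm (X k - Abs_c0 f) \<le> e / 2" if "k \<ge> N" for k
      by (rule norm_c0_leI) (use N[OF that] in \<open>simp add: minus_c0.rep_eq coord_f\<close>)
    then show "\<exists>N. \<forall>k\<ge>N. norm (X k - Abs_c0 f) < e" using e by fastforce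
  qed
  then show "convergent X" unfolding convergent_def by blast
qed


section \<open>Contractions and the strong operator topology\<close>

text \<open>
  The type \<^typ>\<open>c0 \<Rightarrow>\<^sub>L c0\<close> consists of the bounded real-linear maps, so complex
  homogeneity is imposed in addition; the norm is the operator norm.
\<close>

definition complex_contractions :: "(c0 \<Rightarrow>\<^sub>L c0) set" ("\<B>\<^sub>1")
  where "\<B>\<^sub>1 = {T. (\<forall>c x. blinfun_apply T (c *\<^sub>C x) = c *\<^sub>C blinfun_apply T x) \<and> norm T \<le> 1}"

definition SOT_contractions :: "(c0 \<Rightarrow>\<^sub>L c0) topology"
  where "SOT_contractions = subtopology strong_operator_topology \<B>\<^sub>1"

lemma topspace_SOT_contractions [simp]: "topspace SOT_contractions = \<B>\<^sub>1"
  by (simp add: SOT_contractions_def strong_operator_topology_topspace)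


section \<open>Baire category\<close>

definition nowhere_dense_in :: "'a topology \<Rightarrow> 'a set \<Rightarrow> bool"
  where "nowhere_dense_in X S \<longleftrightarrow> S \<subseteq> topspace X \<and> X interior_of (X closure_of S) = {}"

definition meager_in :: "'a topology \<Rightarrow> 'a set \<Rightarrow> bool"
  where "meager_in X S \<longleftrightarrow> (\<exists>\<F>. countable \<F> \<and> (\<forall>N\<in>\<F>. nowhere_dense_in X N) \<and> S = \<Union>\<F>)"

definition comeager_in :: "'a topology \<Rightarrow> 'a set \<Rightarrow> bool"
  where "comeager_in X S \<longleftrightarrow> S \<subseteq> topspace X \<and> meager_in X (topspace X - S)"

definition typical_contraction :: "((c0 \<Rightarrow>\<^sub>L c0) \<Rightarrow> bool) \<Rightarrow> bool"
  where "typical_contraction P \<longleftrightarrow> comeager_in SOT_contractions {T \<in> \<B>\<^sub>1. P T}"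


section \<open>Supercyclic vectors\<close>

definition supercyclic_vector :: "(c0 \<Rightarrow>\<^sub>L c0) \<Rightarrow> c0 \<Rightarrow> bool"
  where "supercyclic_vector T x \<longleftrightarrow>
    closure {c *\<^sub>C (blinfun_apply T ^^ n) x |c n. True} = UNIV"

end

theory Submission
  imports Defs
begin

text \<open>
  For a typical contraction \<open>T\<close> we have \<open>T^n e\<^sub>i \<longlonglongrightarrow> 0\<close> for all \<open>i\<close>, and there are arbitrarily large
  \<open>p\<close> such that \<open>T^n e\<^sub>p\<close> stays close to \<open>e\<^sub>p\<close> for a long time while its zeroth coordinate is small
  for all \<open>n\<close>. Density comes from approximating \<open>A\<close> by \<open>r (P\<^sub>m A P\<^sub>m + P\<^sub>m\<^sub>+\<^sub>1 - P\<^sub>m)\<close> with \<open>r < 1\<close> close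
  to \<open>1\<close>: the new eigenvector \<open>e\<^sub>m\<close> costs no norm because the norm on \<open>c\<^sub>0\<close> is a maximum. Choosing
  \<open>p\<^sub>k\<close> recursively so that \<open>e\<^sub>p\<^sub>k\<close> is almost fixed until all earlier \<open>T^n e\<^sub>p\<^sub>i\<close> have died out, the
  vector \<open>x = \<Sum>\<^sub>k 4\<^sup>-\<^sup>k e\<^sub>p\<^sub>k\<close> satisfies \<open>2 |(T^n x)\<^sub>0| \<le> \<parallel>T^n x\<parallel>\<close> for every \<open>n\<close>, so its
  projective orbit stays away from \<open>e\<^sub>0\<close>.
\<close>

section \<open>Coordinates, unit vectors and truncations\<close>

lemma bounded_linear_coord: "bounded_linear (\<lambda>x. coord x j)"
  by (rule bounded_linear_intro[where K = 1])
    (simp_all add: plus_c0.rep_eq scaleR_c0.rep_eq norm_coord_le)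

lift_definition unit_vec :: "nat \<Rightarrow> c0" is "\<lambda>p j. if j = p then 1 else 0"
  by (rule tendsto_eventually) (use eventually_gt_at_top in \<open>auto elim!: eventually_mono\<close>)

lemma norm_unit_vec [simp]: "norm (unit_vec p) = 1"
proof (rule antisym)
  show "norm (unit_vec p) \<le> 1" by (rule norm_c0_leI) (simp add: unit_vec.rep_eq)
  show "1 \<le> norm (unit_vec p)" using norm_coord_le[of "unit_vec p" p] by (simp add: unit_vec.rep_eq)
qed

lift_definition trunc :: "nat \<Rightarrow> c0 \<Rightarrow> c0" is "\<lambda>m f j. if j < m then f j else 0"
  by (erule tendsto_0_le[where K = 1]) simp

lemma norm_trunc_le: "norm (trunc m x) \<le> norm x"
  by (rule norm_c0_leI) (simp add: trunc.rep_eq norm_coord_le)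

lemma bounded_linear_trunc: "bounded_linear (trunc m)"
  by (rule bounded_linear_intro[where K = 1])
    (auto intro!: c0_eqI simp: plus_c0.rep_eq scaleR_c0.rep_eq trunc.rep_eq norm_trunc_le)

lemma trunc_scaleC: "trunc m (c *\<^sub>C x) = c *\<^sub>C trunc m x"
  by (rule c0_eqI) (simp add: trunc.rep_eq scaleC.rep_eq)

lemma trunc_tendsto: "(\<lambda>m. trunc m x) \<longlonglongrightarrow> x"
proof (rule LIMSEQ_I)
  fix e :: real assume e: "0 < e"
  then obtain M where M: "\<And>n. n \<ge> M \<Longrightarrow> cmod (coord x n) < e / 2"
    using LIMSEQ_D[OF coord_tendsto_0[of x], of "e / 2"] by auto
  have "norm (trunc m x - x) \<le> e / 2" if "m \<ge> M" for m
    by (rule norm_c0_leI)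
      (use that e M in \<open>auto simp: minus_c0.rep_eq trunc.rep_eq not_less intro!: less_imp_le\<close>)
  with e show "\<exists>M. \<forall>m\<ge>M. norm (trunc m x - x) < e" by fastforce
qed

lemma scaleC_plus: "c *\<^sub>C (x + y) = c *\<^sub>C x + c *\<^sub>C y"
  and scaleC_minus: "c *\<^sub>C (x - y) = c *\<^sub>C x - c *\<^sub>C y"
  and scaleC_scaleR: "c *\<^sub>C (r *\<^sub>R x) = r *\<^sub>R (c *\<^sub>C x)"
  by (auto intro!: c0_eqI
      simp: scaleC.rep_eq plus_c0.rep_eq minus_c0.rep_eq scaleR_c0.rep_eq algebra_simps)


section \<open>Powers of contractions\<close>

lemma bounded_linear_funpow: "bounded_linear f \<Longrightarrow> bounded_linear (f ^^ n)"
  for f :: "'a::real_normed_vector \<Rightarrow> 'a"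
  by (induction n) (simp_all add: bounded_linear_compose bounded_linear_ident id_def comp_def)

lemma norm_blinfun_apply_le:
  assumes "norm (T :: 'a::real_normed_vector \<Rightarrow>\<^sub>L 'b::real_normed_vector) \<le> 1"
  shows "norm (blinfun_apply T x) \<le> norm x"
  using norm_blinfun[of T x] mult_right_mono[OF assms norm_ge_zero[of x]] by linarith

lemma norm_funpow_le:
  fixes T :: "'a::real_normed_vector \<Rightarrow>\<^sub>L 'a"
  assumes "norm T \<le> r"
  shows "norm ((blinfun_apply T ^^ n) x) \<le> r ^ n * norm x"
proof (induction n)
  case (Suc n)
  have "norm ((blinfun_apply T ^^ Suc n) x) \<le> norm T * norm ((blinfun_apply T ^^ n) x)"
    by (simp add: norm_blinfun)
  also have "\<dots> \<le> r * (r ^ n * norm x)"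
    using order_trans[OF norm_ge_zero assms] by (intro mult_mono Suc assms) auto
  finally show ?case by (simp add: mult_ac)
qed simp

lemma norm_funpow_antimono:
  fixes T :: "'a::real_normed_vector \<Rightarrow>\<^sub>L 'a"
  assumes T: "norm T \<le> 1" and "m \<le> n"
  shows "norm ((blinfun_apply T ^^ n) x) \<le> norm ((blinfun_apply T ^^ m) x)"
  using lift_Suc_antimono_le[of "\<lambda>n. norm ((blinfun_apply T ^^ n) x)", OF _ \<open>m \<le> n\<close>]
    norm_blinfun_apply_le[OF T] by simp


section \<open>The non-supercyclic vector\<close>

text \<open>Padding the tail with zeros keeps it indexed from 0, so that tail majorants can be added
  termwise to majorants over all indices.\<close>

lemma quarter_tail_sums:
  "(\<lambda>i. if i < m then 0 else (1/4) ^ i) sums ((1/4) ^ m * (4/3 :: real))"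
proof -
  have "(\<lambda>i. (1/4) ^ m * (1/4) ^ i) sums ((1/4) ^ m * (4/3 :: real))"
    using geometric_sums[of "1/4 :: real"] by (intro sums_mult) simp
  then have "(\<lambda>i. if i + m < m then 0 else (1/4) ^ (i + m)) sums ((1/4) ^ m * (4/3 :: real))"
    by (simp add: power_add mult.commute)
  then show ?thesis by (subst (asm) sums_zero_iff_shift) auto
qed

lemma norm_suminf_le_sums:
  fixes f :: "nat \<Rightarrow> 'a::banach"
  assumes "\<And>i. norm (f i) \<le> g i" "g sums s"
  shows "norm (suminf f) \<le> s"
  using norm_suminf_le[of f g] assms by (simp add: sums_iff)

text \<open>A snapshot at one time n, with \<open>v i\<close> in the role of T^n applied to the i-th
  chosen unit vector. Vectors before index m have died out, the one at \<open>Suc m\<close> is still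
  almost \<open>unit_vec q\<close>, and index m may be in any intermediate state. Since weight m is
  only 4 times weight \<open>Suc m\<close>, the 1/100 bound on coordinate 0 absorbs it, while
  coordinate q keeps more than half of weight \<open>Suc m\<close>.\<close>

lemma weighted_sum_coord_estimate:
  fixes v :: "nat \<Rightarrow> c0" and q :: nat
  assumes le1: "\<And>i. norm (v i) \<le> 1"
    and zero: "\<And>i. cmod (coord (v i) 0) \<le> 1/100"
    and early: "\<And>i. i < m \<Longrightarrow> norm (v i) \<le> (1/4) ^ m / 100"
    and fixed: "norm (v (Suc m) - unit_vec q) \<le> 1/100"
    and disjoint: "\<And>i. i < Suc m \<Longrightarrow> cmod (coord (v i) q) \<le> (1/4) ^ Suc m / 100"
  shows "2 * cmod (coord (\<Sum>i. (1/4) ^ i *\<^sub>R v i) 0) < norm (\<Sum>i. (1/4) ^ i *\<^sub>R v i)"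
proof -
  define a :: "nat \<Rightarrow> real" where "a = (\<lambda>i. (1/4) ^ i)"
  define y where "y = (\<Sum>i. a i *\<^sub>R v i)"
  have a_pos: "0 < a i" for i by (simp add: a_def)
  have a_tail: "(\<lambda>i. if i < k then 0 else a i) sums (a k * (4/3))" for k
    unfolding a_def by (rule quarter_tail_sums)
  have a_sums: "a sums (4/3)" using a_tail[of 0] by (simp add: a_def)
  have am: "a m = 4 * a (Suc m)" by (simp add: a_def)
  have bound: "norm (a i *\<^sub>R v i) \<le> a i" for i
    using mult_left_mono[OF le1[of i] less_imp_le[OF a_pos[of i]]] a_pos[of i] by simp
  have summ: "summable (\<lambda>i. a i *\<^sub>R v i)"
    by (rule summable_comparison_test'[OF sums_summable[OF a_sums] bound])
  have coord_y: "coord y j = (\<Sum>i. a i *\<^sub>R coord (v i) j)"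
    and coord_summ: "summable (\<lambda>i. a i *\<^sub>R coord (v i) j)" for j
    using bounded_linear.suminf[OF bounded_linear_coord[of j] summ]
      bounded_linear.summable[OF bounded_linear_coord[of j] summ]
    by (simp_all add: y_def scaleR_c0.rep_eq)
  \<comment> \<open>Indices below m are controlled by \<open>early\<close>, all others by
    \<open>zero\<close>; the total is 8/300 of \<open>a m\<close>, that is 32/300 of
    \<open>a (Suc m)\<close>.\<close>
  have "cmod (\<Sum>i. a i *\<^sub>R coord (v i) 0) \<le> 4/3 * (a m / 100) + a m * (4/3) * (1/100)"
  proof (rule norm_suminf_le_sums)
    show "(\<lambda>i. a i * (a m / 100) + (if i < m then 0 else a i) * (1/100)) sums
        (4/3 * (a m / 100) + a m * (4/3) * (1/100))"
      by (intro sums_add sums_mult2 a_sums a_tail)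
    fix i
    have "cmod (coord (v i) 0) \<le> a m / 100 + (if i < m then 0 else 1/100)"
    proof (cases "i < m")
      case True
      then show ?thesis using early[OF True] norm_coord_le[of "v i" 0] by (simp add: a_def)
    next
      case False
      then show ?thesis using zero[of i] a_pos[of m] by simp
    qed
    from mult_left_mono[OF this, of "a i"] a_pos[of i]
    show "cmod (a i *\<^sub>R coord (v i) 0) \<le> a i * (a m / 100) + (if i < m then 0 else a i) * (1/100)"
      by (simp add: algebra_simps split: if_splits)
  qed
  then have upper: "cmod (coord y 0) \<le> 32/300 * a (Suc m)" by (simp add: coord_y am)
  \<comment> \<open>\<open>?d\<close> is the contribution to coordinate q that an exactly fixed
    vector would make. The error has three sources: earlier vectors (\<open>disjoint\<close>), later
    ones (only their weights, a third of \<open>a (Suc m)\<close> in total), and the deviation 1/100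
    of the fixed one.\<close>
  let ?d = "\<lambda>i. if i = Suc m then complex_of_real (a i) else 0"
  have "cmod (\<Sum>i. a i *\<^sub>R coord (v i) q - ?d i) \<le>
      4/3 * (a (Suc m) / 100) + a (Suc (Suc m)) * (4/3) + a (Suc m) * (1/100)"
  proof (rule norm_suminf_le_sums)
    show "(\<lambda>i. a i * (a (Suc m) / 100) + (if i < Suc (Suc m) then 0 else a i)
        + (if i = Suc m then a i else 0) * (1/100)) sums
        (4/3 * (a (Suc m) / 100) + a (Suc (Suc m)) * (4/3) + a (Suc m) * (1/100))"
      by (intro sums_add sums_mult2 a_sums a_tail sums_single)
    fix i
    consider "i < Suc m" | "i = Suc m" | "i > Suc m" by linarith
    then show "cmod (a i *\<^sub>R coord (v i) q - ?d i) \<le> a i * (a (Suc m) / 100)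
        + (if i < Suc (Suc m) then 0 else a i) + (if i = Suc m then a i else 0) * (1/100)"
    proof cases
      case 1
      then show ?thesis
        using mult_left_mono[OF disjoint[OF 1], of "a i"] a_pos[of i] by (simp add: a_def)
    next
      case 2
      have "cmod (coord (v i) q - 1) \<le> 1/100"
        using norm_coord_le[of "v (Suc m) - unit_vec q" q] fixed 2
        by (simp add: minus_c0.rep_eq unit_vec.rep_eq)
      moreover have "a i *\<^sub>R coord (v i) q - ?d i = a i *\<^sub>R (coord (v i) q - 1)"
        using 2 by (simp add: scaleR_conv_of_real algebra_simps)
      ultimately have "cmod (a i *\<^sub>R coord (v i) q - ?d i) \<le> a i * (1/100)"
        using a_pos[of i] by (simp add: mult_left_mono del: scaleR_conv_of_real)
      then show ?thesis
        using 2 mult_pos_pos[OF a_pos[of "Suc m"] a_pos[of "Suc m"]] by simp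
    next
      case 3
      have "cmod (coord (v i) q) \<le> 1" using norm_coord_le[of "v i" q] le1[of i] by linarith
      then have "a i * cmod (coord (v i) q) \<le> a i * (a (Suc m) / 100) + a i"
        using a_pos[of i] a_pos[of "Suc m"]
        by (intro add_increasing mult_left_le) (simp_all add: less_imp_le)
      then show ?thesis using 3 a_pos[of i] by simp
    qed
  qed
  moreover have "(\<Sum>i. a i *\<^sub>R coord (v i) q - ?d i) = coord y q - a (Suc m)"
    unfolding coord_y using sums_single[of "Suc m" "\<lambda>i. complex_of_real (a i)"]
    by (subst suminf_diff[symmetric]) (auto simp: coord_summ sums_iff)
  moreover have "a (Suc (Suc m)) = a (Suc m) / 4" by (simp add: a_def)
  ultimately have "cmod (coord y q - a (Suc m)) \<le> a (Suc m) * (4/300 + 1/3 + 1/100)" by simp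
  moreover have "a (Suc m) - cmod (coord y q - a (Suc m)) \<le> cmod (coord y q)"
    using norm_triangle_ineq2[of "complex_of_real (a (Suc m))" "complex_of_real (a (Suc m)) - coord y q"]
      a_pos[of "Suc m"] by (simp add: norm_minus_commute)
  \<comment> \<open>Numerically 1 - 4/300 - 1/3 - 1/100 exceeds 1/2, whereas twice the bound on
    coordinate 0 is only 64/300.\<close>
  ultimately have "a (Suc m) * (1/2) < norm y"
    using norm_coord_le[of y q] a_pos[of "Suc m"] by (simp add: algebra_simps)
  with upper a_pos[of "Suc m"] have "2 * cmod (coord y 0) < norm y" by linarith
  then show ?thesis by (simp add: y_def a_def)
qed

text \<open>The inequality cuts out a closed set that is stable under complex scaling. It contains
  the whole projective orbit but not \<open>unit_vec 0\<close>, for which it would read 2 \<le>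
  1.\<close>

lemma not_supercyclicI:
  assumes "\<And>n. 2 * cmod (coord ((blinfun_apply T ^^ n) x) 0) \<le> norm ((blinfun_apply T ^^ n) x)"
  shows "\<not> supercyclic_vector T x"
proof
  assume "supercyclic_vector T x"
  then have "unit_vec 0 \<in> closure {c *\<^sub>C (blinfun_apply T ^^ n) x |c n. True}"
    by (simp add: supercyclic_vector_def)
  moreover have "closed {z. 2 * cmod (coord z 0) \<le> norm z}"
    by (intro closed_Collect_le continuous_intros bounded_linear.continuous_on[OF bounded_linear_coord])
  moreover have "{c *\<^sub>C (blinfun_apply T ^^ n) x |c n. True} \<subseteq> {z. 2 * cmod (coord z 0) \<le> norm z}"
    using mult_left_mono[OF assms norm_ge_zero]
    by (auto simp: norm_scaleC scaleC.rep_eq norm_mult mult.left_commute)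
  ultimately have "unit_vec 0 \<in> {z. 2 * cmod (coord z 0) \<le> norm z}"
    using closure_minimal by blast
  then show False by (simp add: unit_vec.rep_eq)
qed

text \<open>One step of the recursion, with \<open>F\<close> the indices chosen so far. Both
  requirements on p concern a finite time window, because after some time M every orbit starting in
  \<open>F\<close> stays below \<tau>.\<close>

lemma ex_next_unit_vec:
  assumes decay: "\<And>i. (\<lambda>n. (blinfun_apply T ^^ n) (unit_vec i)) \<longlonglongrightarrow> 0"
    and ex: "\<And>N. \<exists>p\<ge>N. (\<forall>n\<le>N. norm ((blinfun_apply T ^^ n) (unit_vec p) - unit_vec p) \<le> 1/100) \<and>
      (\<forall>n. cmod (coord ((blinfun_apply T ^^ n) (unit_vec p)) 0) \<le> 1/100)"
    and "finite F" and \<tau>: "0 < \<tau>"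
  obtains p where "\<And>n. cmod (coord ((blinfun_apply T ^^ n) (unit_vec p)) 0) \<le> 1/100"
    and "\<And>n i. i \<in> F \<Longrightarrow> norm ((blinfun_apply T ^^ n) (unit_vec i)) > \<tau> \<Longrightarrow>
      norm ((blinfun_apply T ^^ n) (unit_vec p) - unit_vec p) \<le> 1/100"
    and "\<And>n i. i \<in> F \<Longrightarrow> cmod (coord ((blinfun_apply T ^^ n) (unit_vec i)) p) \<le> \<tau>"
proof -
  let ?v = "\<lambda>n i. (blinfun_apply T ^^ n) (unit_vec i)"
  have "\<forall>\<^sub>F n in sequentially. \<forall>i\<in>F. norm (?v n i) < \<tau>"
    using decay \<tau> by (intro eventually_ball_finite \<open>finite F\<close>) (auto simp: tendsto_iff)
  then obtain M where M: "\<And>n i. n \<ge> M \<Longrightarrow> i \<in> F \<Longrightarrow> norm (?v n i) < \<tau>"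
    unfolding eventually_sequentially by blast
  \<comment> \<open>Before time M only finitely many vectors occur, and each is a null sequence, so
    a single threshold P makes all their coordinates beyond it small.\<close>
  have "\<forall>\<^sub>F p in sequentially. \<forall>n\<in>{..<M}. \<forall>i\<in>F. cmod (coord (?v n i) p) < \<tau>"
    using coord_tendsto_0 \<tau>
    by (intro eventually_ball_finite \<open>finite F\<close> finite_lessThan ballI) (auto simp: tendsto_iff)
  then obtain P where P: "\<And>p n i. p \<ge> P \<Longrightarrow> n < M \<Longrightarrow> i \<in> F \<Longrightarrow> cmod (coord (?v n i) p) < \<tau>"
    unfolding eventually_sequentially by blast
  obtain p where p: "p \<ge> max M P" "\<And>n. n \<le> max M P \<Longrightarrow> norm (?v n p - unit_vec p) \<le> 1/100"
      "\<And>n. cmod (coord (?v n p) 0) \<le> 1/100"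
    using ex[of "max M P"] by blast
  show thesis
  proof (rule that[of p])
    show "norm (?v n p - unit_vec p) \<le> 1/100" if "i \<in> F" "norm (?v n i) > \<tau>" for n i
    proof -
      have "n < M" using M[of n i] that by (meson not_less not_less_iff_gr_or_eq)
      then show ?thesis by (intro p) simp
    qed
    show "cmod (coord (?v n i) p) \<le> \<tau>" if "i \<in> F" for n i
    proof (cases "n < M")
      case True
      then show ?thesis using P[of p n i] p(1) that by simp
    next
      case False
      then show ?thesis using M[of n i] that norm_coord_le[of "?v n i" p] by simp
    qed
  qed (rule p(3))
qed

lemma ex_not_supercyclic:
  assumes T: "norm T \<le> 1"
    and decay: "\<And>i. (\<lambda>n. (blinfun_apply T ^^ n) (unit_vec i)) \<longlonglongrightarrow> 0"
    and ex: "\<And>N. \<exists>p\<ge>N. (\<forall>n\<le>N. norm ((blinfun_apply T ^^ n) (unit_vec p) - unit_vec p) \<le> 1/100) \<and>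
      (\<forall>n. cmod (coord ((blinfun_apply T ^^ n) (unit_vec p)) 0) \<le> 1/100)"
  shows "\<exists>x. x \<noteq> 0 \<and> \<not> supercyclic_vector T x"
proof -
  let ?v = "\<lambda>n i. (blinfun_apply T ^^ n) (unit_vec i)"
  define \<tau> :: "nat \<Rightarrow> real" where "\<tau> k = (1/4) ^ k / 100" for k
  \<comment> \<open>The three clauses provide the hypotheses \<open>zero\<close>,
    \<open>fixed\<close> and \<open>disjoint\<close> of the weighted estimate; \<open>early\<close>
    will come from a minimal choice of k.\<close>
  define Q where "Q f k p \<longleftrightarrow> (\<forall>n. cmod (coord (?v n p) 0) \<le> 1/100) \<and>
      (\<forall>n. \<forall>i<k. norm (?v n (f i)) > \<tau> k \<longrightarrow> norm (?v n p - unit_vec p) \<le> 1/100) \<and>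
      (\<forall>n. \<forall>i<k. cmod (coord (?v n (f i)) p) \<le> \<tau> k)" for f :: "nat \<Rightarrow> nat" and k p
  have "\<exists>p. \<forall>k. Q p k (p k)"
  \<comment> \<open>\<open>Q f k\<close> looks at f only below k, so the sequence can be built by
    well-founded recursion.\<close>
  proof (rule dependent_wf_choice[OF wf_less_than])
    show "Q f k r = Q g k r" if "\<And>z. (z, k) \<in> less_than \<Longrightarrow> f z = g z" for f g k r
      using that by (simp add: Q_def)
    show "\<exists>r. Q f k r" for f k
    proof -
      have "finite (f ` {..<k})" "0 < \<tau> k" by (simp_all add: \<tau>_def)
      from ex_next_unit_vec[OF decay ex this]
      obtain r where "\<And>n. cmod (coord (?v n r) 0) \<le> 1/100"
        "\<And>n i. i \<in> f ` {..<k} \<Longrightarrow> norm (?v n i) > \<tau> k \<Longrightarrow> norm (?v n r - unit_vec r) \<le> 1/100"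
        "\<And>n i. i \<in> f ` {..<k} \<Longrightarrow> cmod (coord (?v n i) r) \<le> \<tau> k"
        by metis
      then have "Q f k r" unfolding Q_def by blast
      then show ?thesis ..
    qed
  qed
  then obtain p where p: "\<And>k. Q p k (p k)" by blast
  define w where "w n i = ?v n (p i)" for n i
  have w_zero: "cmod (coord (w n i) 0) \<le> 1/100"
    and w_fixed: "i < k \<Longrightarrow> norm (w n i) > \<tau> k \<Longrightarrow> norm (w n k - unit_vec (p k)) \<le> 1/100"
    and w_disjoint: "i < k \<Longrightarrow> cmod (coord (w n i) (p k)) \<le> \<tau> k" for n i k
    using p[of k] p[of i] by (auto simp: Q_def w_def)
  have w_le1: "norm (w n i) \<le> 1" for n i
    using norm_funpow_le[OF T, of n "unit_vec (p i)"] by (simp add: w_def)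
  define x where "x = (\<Sum>i. (1/4) ^ i *\<^sub>R unit_vec (p i))"
  have summ: "summable (\<lambda>i. (1/4) ^ i *\<^sub>R unit_vec (p i))"
    by (rule summable_norm_cancel) simp
  have Tx: "(blinfun_apply T ^^ n) x = (\<Sum>i. (1/4) ^ i *\<^sub>R w n i)" for n
  proof -
    have bl: "bounded_linear (blinfun_apply T ^^ n)"
      by (rule bounded_linear_funpow[OF blinfun.bounded_linear_right])
    show ?thesis
      using bounded_linear.suminf[OF bl summ] linear_cmul[OF bounded_linear.linear[OF bl]]
      by (simp add: x_def w_def)
  qed
  have main: "2 * cmod (coord ((blinfun_apply T ^^ n) x) 0) < norm ((blinfun_apply T ^^ n) x)"
    if "w n i \<noteq> 0" for n i
  proof -
    have "\<exists>k. \<exists>i<k. norm (w n i) > \<tau> k"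
    proof -
      \<comment> \<open>The thresholds tend to 0, so a nonzero vector exceeds all late ones.\<close>
      have "\<tau> \<longlonglongrightarrow> 0" 
        unfolding \<tau>_def by (intro tendsto_divide_zero LIMSEQ_power_zero) simp
      then have "\<forall>\<^sub>F k in sequentially. \<tau> k < norm (w n i)"
        using that by (intro order_tendstoD) auto
      with eventually_gt_at_top[of i] have "\<forall>\<^sub>F k in sequentially. i < k \<and> \<tau> k < norm (w n i)"
        by eventually_elim simp
      then show ?thesis by (auto simp: eventually_sequentially)
    qed
    \<comment> \<open>By \<open>w_fixed\<close> the \<open>k\<close>-th vector is still almost fixed at time \<open>n\<close>; by minimality all vectors
      before the \<open>(k - 1)\<close>-st have died out.\<close>
    then obtain k where k: "\<exists>i<k. norm (w n i) > \<tau> k"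
      and min: "\<And>l. l < k \<Longrightarrow> \<not> (\<exists>i<l. norm (w n i) > \<tau> l)"
      using exists_least_iff[of "\<lambda>k. \<exists>i<k. norm (w n i) > \<tau> k"] by auto
    from k obtain m where m: "k = Suc m" by (cases k) auto
    show ?thesis unfolding Tx
    proof (rule weighted_sum_coord_estimate[where m = m and q = "p k"])
      show "norm (w n i) \<le> (1/4) ^ m / 100" if "i < m" for i
      proof -
        have "\<not> norm (w n i) > \<tau> m" using min[of m] that m by blast
        then show ?thesis by (simp add: \<tau>_def)
      qed
      show "norm (w n (Suc m) - unit_vec (p k)) \<le> 1/100"
        using k w_fixed m by blast
      show "cmod (coord (w n i) (p k)) \<le> (1/4) ^ Suc m / 100" if "i < Suc m" for i
        using w_disjoint[of i k n] that by (simp add: m \<tau>_def)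
    qed (rule w_le1 w_zero)+
  qed
  \<comment> \<open>At time 0 the vectors are unit vectors, so \<open>main\<close> applies, and its
    strict inequality rules out x = 0.\<close>
  have "x \<noteq> 0"
  proof -
    have "norm (w 0 0) = 1" by (simp add: w_def)
    then have "w 0 0 \<noteq> 0" by auto
    from main[OF this] show ?thesis by auto
  qed
  moreover have "\<not> supercyclic_vector T x"
  proof (rule not_supercyclicI)
    fix n
    show "2 * cmod (coord ((blinfun_apply T ^^ n) x) 0) \<le> norm ((blinfun_apply T ^^ n) x)"
    \<comment> \<open>If every orbit has vanished at time n, then so has T^n x and both sides are
      0.\<close>
    proof (cases "\<forall>i. w n i = 0")
      case True
      then show ?thesis by (simp add: Tx zero_c0.rep_eq)
    next
      case False
      then show ?thesis using main less_imp_le by blast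
    qed
  qed
  ultimately show ?thesis by blast
qed


section \<open>Open dense sets of contractions\<close>

lemma continuous_map_funpow_SOT:
  "continuous_map SOT_contractions euclidean (\<lambda>T. (blinfun_apply T ^^ n) x)"
proof (induction n)
  case (Suc n)
  \<comment> \<open>With z = T^n x, split T z - S (S^n x) as (T z - S z) + S (z - S^n x). The first
    term is small by evaluation at the fixed vector z, the second by induction because S is a
    contraction.\<close>
  have "\<exists>U. openin SOT_contractions U \<and> T \<in> U \<and>
      (\<forall>S\<in>U. dist ((blinfun_apply T ^^ Suc n) x) ((blinfun_apply S ^^ Suc n) x) < e)"
    if T: "T \<in> \<B>\<^sub>1" and e: "0 < e" for T e
  proof -
    let ?z = "(blinfun_apply T ^^ n) x"
    have "continuous_map SOT_contractions euclidean (\<lambda>S. blinfun_apply S ?z)"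
      unfolding SOT_contractions_def
      by (intro continuous_map_from_subtopology strong_operator_topology_continuous_evaluation)
    then have "openin SOT_contractions {S \<in> \<B>\<^sub>1. blinfun_apply S ?z \<in> ball (blinfun_apply T ?z) (e/2)}"
        (is "openin _ ?U1")
      using openin_continuous_map_preimage[of SOT_contractions euclidean "\<lambda>S. blinfun_apply S ?z"
          "ball (blinfun_apply T ?z) (e/2)"] by simp
    moreover have "openin SOT_contractions {S \<in> \<B>\<^sub>1. (blinfun_apply S ^^ n) x \<in> ball ?z (e/2)}"
        (is "openin _ ?U2")
      using openin_continuous_map_preimage[OF Suc, of "ball ?z (e/2)"] by simp
    ultimately have "openin SOT_contractions (?U1 \<inter> ?U2)" by (rule openin_Int)
    moreover have "T \<in> ?U1 \<inter> ?U2" using T e by simp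
    moreover have "dist ((blinfun_apply T ^^ Suc n) x) ((blinfun_apply S ^^ Suc n) x) < e"
      if S: "S \<in> ?U1 \<inter> ?U2" for S
    proof -
      have "norm S \<le> 1" using S by (simp add: complex_contractions_def)
      then have "norm (blinfun_apply S (?z - (blinfun_apply S ^^ n) x)) \<le> norm (?z - (blinfun_apply S ^^ n) x)"
        by (rule norm_blinfun_apply_le)
      also have "\<dots> < e/2" using S by (simp add: dist_norm)
      finally have "dist (blinfun_apply S ?z) (blinfun_apply S ((blinfun_apply S ^^ n) x)) < e/2"
        by (simp add: dist_norm blinfun.diff_right)
      moreover have "dist (blinfun_apply T ?z) (blinfun_apply S ?z) < e/2" using S by simp
      ultimately show ?thesis
        using dist_triangle[of "blinfun_apply T ?z" "blinfun_apply S ((blinfun_apply S ^^ n) x)"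
            "blinfun_apply S ?z"] by simp
    qed
    ultimately show ?thesis by blast
  qed
  then have "continuous_map SOT_contractions Met_TC.mtopology (\<lambda>T. (blinfun_apply T ^^ Suc n) x)"
    unfolding Met_TC.continuous_map_to_metric by (simp del: funpow.simps)
  then show ?case by (simp only: mtopology_is_euclidean)
qed simp

lemma openin_SOT_funpow:
  assumes "open U"
  shows "openin SOT_contractions {T \<in> \<B>\<^sub>1. (blinfun_apply T ^^ n) x \<in> U}"
  using openin_continuous_map_preimage[OF continuous_map_funpow_SOT, of U n x] assms by simp

text \<open>The strong operator topology is the pullback of the product topology under
  \<open>blinfun_apply\<close>, and convergence in a product is pointwise.\<close>

lemma limitin_SOT_contractions:
  assumes "\<And>x. (\<lambda>m. blinfun_apply (B m) x) \<longlonglongrightarrow> blinfun_apply A x"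
    and "\<And>m. B m \<in> \<B>\<^sub>1" "A \<in> \<B>\<^sub>1"
  shows "limitin SOT_contractions B A sequentially"
proof -
  have "limitin (product_topology (\<lambda>_. euclidean) UNIV)
      (\<lambda>m. blinfun_apply (B m)) (blinfun_apply A) sequentially"
    unfolding limitin_componentwise using assms(1) by simp
  then have lim: "(\<lambda>m. blinfun_apply (B m)) \<longlonglongrightarrow> blinfun_apply A"
    by (simp add: euclidean_product_topology)
  have "limitin strong_operator_topology B A sequentially"
    unfolding limitin_def strong_operator_topology_topspace
  proof (intro conjI allI impI UNIV_I)
    fix W assume W: "openin strong_operator_topology W \<and> A \<in> W"
    then obtain U where U: "open U" "W = blinfun_apply -` U"
      unfolding strong_operator_topology_def openin_pullback_topology by auto
    then show "\<forall>\<^sub>F m in sequentially. B m \<in> W"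
      using topological_tendstoD[OF lim U(1)] W by simp
  qed
  then show ?thesis
    unfolding SOT_contractions_def limitin_subtopology using assms(2,3) by auto
qed

section \<open>Finite-block approximations with an added eigenvector\<close>

lift_definition diag_approx :: "(c0 \<Rightarrow>\<^sub>L c0) \<Rightarrow> real \<Rightarrow> nat \<Rightarrow> (c0 \<Rightarrow>\<^sub>L c0)" is
  "\<lambda>A r m x. r *\<^sub>R (trunc m (A (trunc m x)) + (trunc (Suc m) x - trunc m x))"
  by (intro bounded_linear_intros bounded_linear_compose[OF bounded_linear_trunc]
      bounded_linear_compose[OF _ bounded_linear_trunc] bounded_linear_trunc)

text \<open>Each coordinate receives a contribution from at most one of the two summands: the block
  of A below m, the entry of x at m, and nothing beyond. In the supremum norm these do not add
  up.\<close>

lemma norm_diag_approx_le: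
  assumes "norm A \<le> 1" "0 \<le> r"
  shows "norm (diag_approx A r m) \<le> r"
proof (rule norm_blinfun_bound)
  fix x
  have "norm (trunc m (blinfun_apply A (trunc m x)) + (trunc (Suc m) x - trunc m x)) \<le> norm x"
  proof (rule norm_c0_leI)
    fix j
    have "norm (blinfun_apply A (trunc m x)) \<le> norm x"
      using norm_blinfun_apply_le[OF assms(1)] norm_trunc_le order_trans by blast
    then have "cmod (coord (blinfun_apply A (trunc m x)) j) \<le> norm x"
      using norm_coord_le order_trans by blast
    then show "cmod (coord (trunc m (blinfun_apply A (trunc m x)) + (trunc (Suc m) x - trunc m x)) j)
        \<le> norm x"
      by (auto simp: plus_c0.rep_eq minus_c0.rep_eq trunc.rep_eq norm_coord_le)
  qed
  then show "norm (blinfun_apply (diag_approx A r m) x) \<le> r * norm x"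
    using assms(2) by (simp add: diag_approx.rep_eq mult_left_mono)
qed (use assms in auto)

lemma diag_approx_in_contractions:
  assumes "A \<in> \<B>\<^sub>1" "0 \<le> r" "r \<le> 1"
  shows "diag_approx A r m \<in> \<B>\<^sub>1"
  using assms norm_diag_approx_le[of A r m]
  by (auto simp: complex_contractions_def diag_approx.rep_eq trunc_scaleC
      scaleC_plus scaleC_minus scaleC_scaleR)

lemma diag_approx_unit_vec: "blinfun_apply (diag_approx A r m) (unit_vec m) = r *\<^sub>R unit_vec m"
proof -
  have "trunc m (unit_vec m) = 0" "trunc (Suc m) (unit_vec m) = unit_vec m"
    by (auto intro!: c0_eqI simp: trunc.rep_eq unit_vec.rep_eq zero_c0.rep_eq)
  moreover have "trunc m 0 = 0" by (auto intro!: c0_eqI simp: trunc.rep_eq zero_c0.rep_eq)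
  ultimately show ?thesis by (simp add: diag_approx.rep_eq)
qed

lemma diag_approx_funpow_unit_vec:
  "(blinfun_apply (diag_approx A r m) ^^ n) (unit_vec m) = r ^ n *\<^sub>R unit_vec m"
  by (induction n) (simp_all add: blinfun.scaleR_right diag_approx_unit_vec)

lemma diag_approx_tendsto:
  assumes "norm A \<le> 1" "r \<longlonglongrightarrow> 1"
  shows "(\<lambda>m. blinfun_apply (diag_approx A (r m) m) x) \<longlonglongrightarrow> blinfun_apply A x"
proof -
  \<comment> \<open>Truncations and A are contractive, so replacing \<open>trunc m x\<close> by x
    inside A costs at most the truncation error of x.\<close>
  have "(\<lambda>m. trunc m (blinfun_apply A (trunc m x) - blinfun_apply A x)) \<longlonglongrightarrow> 0"
  proof (rule Lim_null_comparison)
    show "\<forall>\<^sub>F m in sequentially. norm (trunc m (blinfun_apply A (trunc m x) - blinfun_apply A x))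
        \<le> norm (trunc m x - x)"
      using order_trans[OF norm_trunc_le norm_blinfun_apply_le[OF assms(1)]]
      by (simp add: blinfun.diff_right[symmetric])
    show "(\<lambda>m. norm (trunc m x - x)) \<longlonglongrightarrow> 0"
      using tendsto_norm_zero[OF LIM_zero[OF trunc_tendsto]] .
  qed
  from tendsto_add[OF this trunc_tendsto[of "blinfun_apply A x"]]
  have "(\<lambda>m. trunc m (blinfun_apply A (trunc m x))) \<longlonglongrightarrow> blinfun_apply A x"
    by (simp add: linear_diff[OF bounded_linear.linear[OF bounded_linear_trunc]])
  then have "(\<lambda>m. r m *\<^sub>R (trunc m (blinfun_apply A (trunc m x)) + (trunc (Suc m) x - trunc m x)))
      \<longlonglongrightarrow> 1 *\<^sub>R (blinfun_apply A x + (x - x))"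
    by (intro tendsto_intros assms trunc_tendsto LIMSEQ_Suc)
  then show ?thesis by (simp add: diag_approx.rep_eq)
qed

section \<open>Nowhere dense complements and comeager sets\<close>

lemma nowhere_dense_in_SOT_complement:
  assumes op: "openin SOT_contractions G"
    and ev: "\<And>A. A \<in> \<B>\<^sub>1 \<Longrightarrow> \<forall>\<^sub>F m in sequentially. diag_approx A (1 - inverse (real (Suc m))) m \<in> G"
  shows "nowhere_dense_in SOT_contractions (\<B>\<^sub>1 - G)"
proof -
  have "closedin SOT_contractions (\<B>\<^sub>1 - G)" using closedin_diff[OF closedin_topspace op] by simp
  then have "SOT_contractions closure_of (\<B>\<^sub>1 - G) = \<B>\<^sub>1 - G" by (rule closure_of_closedin)
  moreover have "SOT_contractions interior_of (\<B>\<^sub>1 - G) = {}"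
  proof (rule ccontr)
    assume "SOT_contractions interior_of (\<B>\<^sub>1 - G) \<noteq> {}"
    then obtain W A where W: "openin SOT_contractions W" "W \<subseteq> \<B>\<^sub>1 - G" and A: "A \<in> W"
      by (auto simp: interior_of_def)
    define r :: "nat \<Rightarrow> real" where "r m = 1 - inverse (real (Suc m))" for m
    have AB: "A \<in> \<B>\<^sub>1" using W A by auto
    \<comment> \<open>The approximants converge to A, hence eventually enter its neighbourhood W; by
      \<open>ev\<close> they eventually lie in G as well, although W avoids G.\<close>
    have "limitin SOT_contractions (\<lambda>m. diag_approx A (r m) m) A sequentially"
    proof (rule limitin_SOT_contractions)
      have "r \<longlonglongrightarrow> 1"
        unfolding r_def using tendsto_diff[OF tendsto_const LIMSEQ_inverse_real_of_nat, of 1] by simp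
      then show "(\<lambda>m. blinfun_apply (diag_approx A (r m) m) x) \<longlonglongrightarrow> blinfun_apply A x" for x
        using AB by (intro diag_approx_tendsto) (auto simp: complex_contractions_def)
      show "diag_approx A (r m) m \<in> \<B>\<^sub>1" for m
        by (rule diag_approx_in_contractions[OF AB]) (auto simp: r_def field_simps power2_eq_square)
    qed (rule AB)
    then have "\<forall>\<^sub>F m in sequentially. diag_approx A (r m) m \<in> W"
      using W A by (auto simp: limitin_def)
    with ev[OF AB] have "\<forall>\<^sub>F m in sequentially. False"
      unfolding r_def by eventually_elim (use W in auto)
    then show False by simp
  qed
  ultimately show ?thesis by (simp add: nowhere_dense_in_def)
qed

text \<open>\<open>meager_in\<close> asks for an exact union of nowhere dense sets, so each
  complement of a member of \<open>\<G>\<close> is cut down to its part outside S; subsets of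
  nowhere dense sets remain nowhere dense.\<close>

lemma comeager_inI:
  assumes "countable \<G>" "\<And>G. G \<in> \<G> \<Longrightarrow> nowhere_dense_in X (topspace X - G)"
    and "S \<subseteq> topspace X" "topspace X \<inter> \<Inter>\<G> \<subseteq> S"
  shows "comeager_in X S"
  unfolding comeager_in_def meager_in_def
proof (intro conjI exI)
  show "countable ((\<lambda>G. (topspace X - G) - S) ` \<G>)" using assms(1) by simp
  show "\<forall>N\<in>(\<lambda>G. (topspace X - G) - S) ` \<G>. nowhere_dense_in X N"
  proof clarify
    fix G assume "G \<in> \<G>"
    moreover have "X interior_of (X closure_of (topspace X - G - S))
        \<subseteq> X interior_of (X closure_of (topspace X - G))"
      by (intro interior_of_mono closure_of_mono) auto
    ultimately show "nowhere_dense_in X (topspace X - G - S)"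
      using assms(2) unfolding nowhere_dense_in_def by blast
  qed
  show "topspace X - S = \<Union> ((\<lambda>G. (topspace X - G) - S) ` \<G>)" using assms(4) by blast
qed (rule assms(3))

section \<open>The two countable families of open dense sets\<close>

definition decaying :: "nat \<Rightarrow> nat \<Rightarrow> (c0 \<Rightarrow>\<^sub>L c0) set" where
  "decaying i k = {T \<in> \<B>\<^sub>1. \<exists>n. norm ((blinfun_apply T ^^ n) (unit_vec i)) < 1 / Suc k}"

text \<open>
  The cut-off \<open>M\<close> makes the bound on the zeroth coordinate an open condition; for a contraction it
  extends to all later times.
\<close>

definition slowly_moving :: "nat \<Rightarrow> (c0 \<Rightarrow>\<^sub>L c0) set" where
  "slowly_moving N = {T \<in> \<B>\<^sub>1. \<exists>p\<ge>N.
    (\<forall>n\<le>N. norm ((blinfun_apply T ^^ n) (unit_vec p) - unit_vec p) < 1/100) \<and>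
    (\<exists>M. norm ((blinfun_apply T ^^ M) (unit_vec p)) < 1/100 \<and>
      (\<forall>n\<le>M. cmod (coord ((blinfun_apply T ^^ n) (unit_vec p)) 0) < 1/100))}"

lemma openin_decaying: "openin SOT_contractions (decaying i k)"
proof -
  have "openin SOT_contractions {T \<in> \<B>\<^sub>1. (blinfun_apply T ^^ n) (unit_vec i) \<in> {z. norm z < 1 / Suc k}}"
    for n by (intro openin_SOT_funpow open_Collect_less continuous_intros)
  then have "openin SOT_contractions
      (\<Union>n. {T \<in> \<B>\<^sub>1. (blinfun_apply T ^^ n) (unit_vec i) \<in> {z. norm z < 1 / Suc k}})"
    by (intro openin_Union) blast
  also have "\<dots> = decaying i k" by (auto simp: decaying_def)
  finally show ?thesis .
qed

text \<open>For fixed p and M only finitely many times are constrained, so the set is a union of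
  finite intersections of open preimages.\<close>

lemma openin_slowly_moving: "openin SOT_contractions (slowly_moving N)"
proof -
  let ?D = "\<lambda>p n. {T \<in> \<B>\<^sub>1. (blinfun_apply T ^^ n) (unit_vec p) \<in> {z. norm (z - unit_vec p) < 1/100}}"
  let ?S = "\<lambda>p n. {T \<in> \<B>\<^sub>1. (blinfun_apply T ^^ n) (unit_vec p) \<in> {z. norm z < 1/100}}"
  let ?C = "\<lambda>p n. {T \<in> \<B>\<^sub>1. (blinfun_apply T ^^ n) (unit_vec p) \<in> {z. cmod (coord z 0) < 1/100}}"
  have D: "openin SOT_contractions (?D p n)" and S: "openin SOT_contractions (?S p n)"
    and C: "openin SOT_contractions (?C p n)" for p n
    by (intro openin_SOT_funpow open_Collect_less continuous_intros
        bounded_linear.continuous_on[OF bounded_linear_coord])+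
  have "openin SOT_contractions ((\<Inter>n\<in>{..N}. ?D p n) \<inter> (?S p M \<inter> (\<Inter>n\<in>{..M}. ?C p n)))" for p M
  proof (intro openin_Int S)
    show "openin SOT_contractions (\<Inter>n\<in>{..N}. ?D p n)"
      by (rule openin_Inter) (use D in auto)
    show "openin SOT_contractions (\<Inter>n\<in>{..M}. ?C p n)"
      by (rule openin_Inter) (use C in auto)
  qed
  then have "openin SOT_contractions
      (\<Union>p\<in>{N..}. \<Union>M. (\<Inter>n\<in>{..N}. ?D p n) \<inter> (?S p M \<inter> (\<Inter>n\<in>{..M}. ?C p n)))"
    by (intro openin_Union) (blast intro: openin_Union)
  also have "\<dots> = slowly_moving N"
    by (auto simp: slowly_moving_def)
  finally show ?thesis .
qed

text \<open>The factor r bounds the norm of the whole operator, so its powers decay geometrically on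
  every vector.\<close>

lemma diag_approx_decaying:
  assumes "A \<in> \<B>\<^sub>1" "0 \<le> r" "r < 1"
  shows "diag_approx A r m \<in> decaying i k"
proof -
  obtain n where "r ^ n < 1 / Suc k"
    using real_arch_pow_inv[of "1 / Suc k" r] assms(3) by auto
  then have "norm ((blinfun_apply (diag_approx A r m) ^^ n) (unit_vec i)) < 1 / Suc k"
    using norm_funpow_le[OF norm_diag_approx_le[of A r m], of n "unit_vec i"] assms
    by (simp add: complex_contractions_def)
  then show ?thesis
    using diag_approx_in_contractions[of A r m] assms by (auto simp: decaying_def)
qed

text \<open>The witness is p = m, an eigenvector with eigenvalue r: it has barely shrunk up to time
  N because r^N > 99/100, it dies out later because r < 1, and its orbit has zeroth coordinate 0
  because m \<noteq> 0.\<close>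

lemma diag_approx_slowly_moving:
  assumes "A \<in> \<B>\<^sub>1" "0 \<le> r" "r < 1" and m: "m \<ge> N" "m \<noteq> 0" and r: "r ^ N > 99/100"
  shows "diag_approx A r m \<in> slowly_moving N"
proof -
  let ?v = "\<lambda>n. (blinfun_apply (diag_approx A r m) ^^ n) (unit_vec m)"
  have "norm (?v n - unit_vec m) < 1/100" if "n \<le> N" for n
  proof -
    have "?v n - unit_vec m = (r ^ n - 1) *\<^sub>R unit_vec m"
      by (simp add: diag_approx_funpow_unit_vec scaleR_diff_left)
    moreover have "r ^ N \<le> r ^ n" "r ^ n \<le> 1"
      using that assms(2,3) by (auto intro: power_decreasing power_le_one)
    ultimately show ?thesis using r by simp
  qed
  moreover obtain M where "r ^ M < 1/100"
    using real_arch_pow_inv[of "1/100" r] assms(3) by auto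
  then have "norm (?v M) < 1/100" using assms(2) by (simp add: diag_approx_funpow_unit_vec)
  moreover have "cmod (coord (?v n) 0) < 1/100" for n
    using m(2) by (simp add: diag_approx_funpow_unit_vec scaleR_c0.rep_eq unit_vec.rep_eq)
  moreover have "diag_approx A r m \<in> \<B>\<^sub>1"
    using assms by (intro diag_approx_in_contractions) auto
  ultimately show ?thesis
    unfolding slowly_moving_def using m(1) by blast
qed

text \<open>Orbit norms of a contraction never increase. Hence one small norm per tolerance already
  gives convergence to 0, and smallness at time M controls coordinate 0 at all later times.\<close>

lemma ex_not_supercyclic_if_decaying_slowly_moving:
  assumes dec: "\<And>i k. T \<in> decaying i k" and slow: "\<And>N. T \<in> slowly_moving N"
  shows "\<exists>x. x \<noteq> 0 \<and> \<not> supercyclic_vector T x"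
proof (rule ex_not_supercyclic)
  show T: "norm T \<le> 1" using dec[of 0 0] by (simp add: decaying_def complex_contractions_def)
  show "(\<lambda>n. (blinfun_apply T ^^ n) (unit_vec i)) \<longlonglongrightarrow> 0" for i
  proof (rule LIMSEQ_I)
    fix e :: real assume "0 < e"
    then obtain k where k: "1 / Suc k < e" using nat_approx_posE by blast
    obtain M where "norm ((blinfun_apply T ^^ M) (unit_vec i)) < 1 / Suc k"
      using dec[of i k] by (auto simp: decaying_def)
    then have "norm ((blinfun_apply T ^^ n) (unit_vec i)) < e" if "n \<ge> M" for n
      using norm_funpow_antimono[OF T that, of "unit_vec i"] k by linarith
    then show "\<exists>M. \<forall>n\<ge>M. norm ((blinfun_apply T ^^ n) (unit_vec i) - 0) < e" by auto
  qed
  show "\<exists>p\<ge>N. (\<forall>n\<le>N. norm ((blinfun_apply T ^^ n) (unit_vec p) - unit_vec p) \<le> 1/100) \<and>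
      (\<forall>n. cmod (coord ((blinfun_apply T ^^ n) (unit_vec p)) 0) \<le> 1/100)" for N
  proof -
    obtain p M where p: "p \<ge> N"
        "\<And>n. n \<le> N \<Longrightarrow> norm ((blinfun_apply T ^^ n) (unit_vec p) - unit_vec p) < 1/100"
      and M: "norm ((blinfun_apply T ^^ M) (unit_vec p)) < 1/100"
        "\<And>n. n \<le> M \<Longrightarrow> cmod (coord ((blinfun_apply T ^^ n) (unit_vec p)) 0) < 1/100"
      using slow[of N] by (auto simp: slowly_moving_def)
    have "cmod (coord ((blinfun_apply T ^^ n) (unit_vec p)) 0) \<le> 1/100" for n
    proof (cases "n \<le> M")
      case True
      then show ?thesis using M(2) by (simp add: less_imp_le)
    next
      case False
      then show ?thesis
        using norm_funpow_antimono[OF T, of M n "unit_vec p"] M(1)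
          norm_coord_le[of "(blinfun_apply T ^^ n) (unit_vec p)" 0] by simp
    qed
    then show ?thesis using p less_imp_le by blast
  qed
qed

theorem proposition5p27:
  shows "typical_contraction (\<lambda>T. \<exists>x. x \<noteq> 0 \<and> \<not> supercyclic_vector T x)"
  unfolding typical_contraction_def
proof (rule comeager_inI)
  let ?r = "\<lambda>m. 1 - inverse (real (Suc m))"
  have r: "0 \<le> ?r m" "?r m < 1" for m by (auto simp: field_simps)
  show "countable (range (case_prod decaying) \<union> range slowly_moving)" by simp
  fix G assume "G \<in> range (case_prod decaying) \<union> range slowly_moving"
  then consider (dec) i k where "G = decaying i k" | (slow) N where "G = slowly_moving N" by auto
  then have "nowhere_dense_in SOT_contractions (\<B>\<^sub>1 - G)"
  proof cases
    case dec
    \<comment> \<open>Every m works here, since the factor is always below 1.\<close>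
    show ?thesis unfolding dec
      by (intro nowhere_dense_in_SOT_complement openin_decaying always_eventually allI
          diag_approx_decaying r)
  next
    case slow
    \<comment> \<open>The exponent N is fixed while the factor tends to 1, so the requirement r^N >
      99/100 holds for all large m.\<close>
    have "(\<lambda>m. ?r m ^ N) \<longlonglongrightarrow> (1 - 0) ^ N"
      by (intro tendsto_intros LIMSEQ_inverse_real_of_nat)
    then have "\<forall>\<^sub>F m in sequentially. ?r m ^ N > 99/100"
      by (rule order_tendstoD) simp
    with eventually_ge_at_top[of N] eventually_gt_at_top[of 0]
    have "\<forall>\<^sub>F m in sequentially. m \<ge> N \<and> m \<noteq> 0 \<and> ?r m ^ N > 99/100"
      by eventually_elim simp
    then have "\<forall>\<^sub>F m in sequentially. diag_approx A (?r m) m \<in> slowly_moving N" if "A \<in> \<B>\<^sub>1" for A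
      by (rule eventually_mono) (use that r diag_approx_slowly_moving in blast)
    then show ?thesis unfolding slow
      by (intro nowhere_dense_in_SOT_complement openin_slowly_moving)
  qed
  then show "nowhere_dense_in SOT_contractions (topspace SOT_contractions - G)" by simp
next
  show "topspace SOT_contractions \<inter> \<Inter> (range (case_prod decaying) \<union> range slowly_moving)
      \<subseteq> {T \<in> \<B>\<^sub>1. \<exists>x. x \<noteq> 0 \<and> \<not> supercyclic_vector T x}"
  proof
    fix T assume "T \<in> topspace SOT_contractions \<inter> \<Inter> (range (case_prod decaying) \<union> range slowly_moving)"
    then have T: "T \<in> \<B>\<^sub>1" "\<And>ik. T \<in> case_prod decaying ik" "\<And>N. T \<in> slowly_moving N" by auto
    have "T \<in> decaying i k" for i k using T(2)[of "(i, k)"] by simp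
    with T show "T \<in> {T \<in> \<B>\<^sub>1. \<exists>x. x \<noteq> 0 \<and> \<not> supercyclic_vector T x}"
      using ex_not_supercyclic_if_decaying_slowly_moving by blast
  qed
qed auto

end
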